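(* For every positive integer $k$ and $n=18k+3$, $G(n)=6k$; that is, there exists a Steiner triple system on $18k+3$ points containing a cross-free set of size $6k$, and no Steiner triple system on $18k+3$ points contains a cross-free set of size $6k+1$.
   Context: A Steiner triple system STS$(n)$ is a pair $(V,\mathcal{B})$ with $|V|=n$ and $\mathcal{B}$ a family of $3$-element subsets (blocks) of $V$ such that every pair of distinct points lies in exactly one block. A cross-free set of size $m$ in $(V,\mathcal{B})$ is a triple of pairwise disjoint $m$-element subsets $X_1,X_2,X_3\subset V$ such that no block intersects each $X_i$ in exactly one point. $G(n)$ denotes the largest size of a cross-free set present in some STS$(n)$. *)

theory Defs
  imports Main
begin

definition steiner_triple_system :: "nat \<Rightarrow> 'a set \<Rightarrow> 'a set set \<Rightarrow> bool" where
  "steiner_triple_system n V B \<longleftrightarrow>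
     finite V \<and> card V = n \<and>
     (\<forall>b\<in>B. b \<subseteq> V \<and> card b = 3) \<and>
     (\<forall>x\<in>V. \<forall>y\<in>V. x \<noteq> y \<longrightarrow> (\<exists>!b. b \<in> B \<and> x \<in> b \<and> y \<in> b))"

(* Finiteness is required because the cardinality of an infinite set is 0 in HOL. *)
definition cross_free_set ::
  "nat \<Rightarrow> 'a set \<Rightarrow> 'a set set \<Rightarrow> 'a set \<Rightarrow> 'a set \<Rightarrow> 'a set \<Rightarrow> bool" where
  "cross_free_set m V B X1 X2 X3 \<longleftrightarrow>
     X1 \<subseteq> V \<and> X2 \<subseteq> V \<and> X3 \<subseteq> V \<and>
     finite X1 \<and> finite X2 \<and> finite X3 \<and>
     card X1 = m \<and> card X2 = m \<and> card X3 = m \<and>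
     X1 \<inter> X2 = {} \<and> X1 \<inter> X3 = {} \<and> X2 \<inter> X3 = {} \<and>
     \<not> (\<exists>b\<in>B. card (b \<inter> X1) = 1 \<and> card (b \<inter> X2) = 1 \<and> card (b \<inter> X3) = 1)"

(* Points are natural numbers; every finite point set can be relabelled this way.
   The set is bounded by n, and contains 0 whenever an STS(n) exists. *)
definition G :: "nat \<Rightarrow> nat" where
  "G n = Max {m. \<exists>(V :: nat set) B X1 X2 X3.
                   steiner_triple_system n V B \<and> cross_free_set m V B X1 X2 X3}"

end

theory Submission
  imports Defs "HOL-Library.Countable"
begin

text \<open>
  Upper bound: three disjoint sets of size \<open>m = 6k + 1\<close> exhaust the points, so a block meeting both
  \<open>X1\<close> and \<open>X2\<close> misses \<open>X3\<close> and covers exactly two of the \<open>m\<^sup>2\<close> pairs in \<open>X1 \<times> X2\<close>;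
  hence \<open>m\<close> would be even.

  Construction: let \<open>Q\<close> be a commutative quasigroup of order \<open>6k\<close> with holes of size 2, i.e. \<open>x \<circ> y\<close>
  is defined for \<open>x\<close>, \<open>y\<close> in different holes and lies in a third one.
  As in Bose's construction, the triples \<open>{(x, i), (y, i), (x \<circ> y, i + 1)}\<close> on the three levels
  \<open>Q \<times> {i}\<close> cover all pairs of points over different holes and never meet all three levels.
  Add three points \<open>I\<close>. The six points over a hole \<open>{a, b}\<close> together with \<open>I\<close> carry an affine plane
  of order 3 having \<open>I\<close> as a line. The only lines that could meet all three levels are the two
  parallels of \<open>I\<close>, and these are chosen as \<open>{(a, 0), (b, 0), (a, 1)}\<close> and
  \<open>{(b, 1), (a, 2), (b, 2)}\<close>.
\<close>

section \<open>Images and the upper bound\<close>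

lemma steiner_triple_system_image:
  assumes "steiner_triple_system n V B" and inj: "inj_on f V"
  shows "steiner_triple_system n (f ` V) ((`) f ` B)"
proof -
  have sub: "b \<subseteq> V" "card b = 3" if "b \<in> B" for b
    using assms(1) that unfolding steiner_triple_system_def by auto
  have mem: "f x \<in> f ` b \<longleftrightarrow> x \<in> b" if "b \<in> B" "x \<in> V" for x b
    using inj_on_image_mem_iff[OF inj] that sub by blast
  show ?thesis
    unfolding steiner_triple_system_def
  proof (intro conjI ballI impI)
    show "finite (f ` V)" "card (f ` V) = n"
      using assms card_image[OF inj] unfolding steiner_triple_system_def by auto
    fix b assume "b \<in> (`) f ` B"
    then obtain c where "c \<in> B" "b = f ` c" by blast
    then show "b \<subseteq> f ` V" "card b = 3"
      using sub[of c] card_image[OF inj_on_subset[OF inj, of c]] by auto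
  next
    fix p q assume "p \<in> f ` V" "q \<in> f ` V" "p \<noteq> q"
    then obtain x y where xy: "x \<in> V" "y \<in> V" "x \<noteq> y" "p = f x" "q = f y" by auto
    then have "\<exists>!b. b \<in> B \<and> x \<in> b \<and> y \<in> b"
      using assms(1) unfolding steiner_triple_system_def by blast
    then obtain b where b: "b \<in> B" "x \<in> b" "y \<in> b"
      and uniq: "\<And>c. c \<in> B \<Longrightarrow> x \<in> c \<Longrightarrow> y \<in> c \<Longrightarrow> c = b"
      by (elim ex1E conjE) blast
    show "\<exists>!b. b \<in> (`) f ` B \<and> p \<in> b \<and> q \<in> b"
    proof (rule ex1I[of _ "f ` b"])
      show "f ` b \<in> (`) f ` B \<and> p \<in> f ` b \<and> q \<in> f ` b" using b xy by blast
      fix d assume "d \<in> (`) f ` B \<and> p \<in> d \<and> q \<in> d"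
      then obtain c where "c \<in> B" "d = f ` c" "p \<in> f ` c" "q \<in> f ` c" by blast
      then show "d = f ` b" using mem[of c] uniq[of c] xy by simp
    qed
  qed
qed

lemma cross_free_set_image:
  assumes "cross_free_set m V B X1 X2 X3" and inj: "inj_on f V" and sub: "\<And>b. b \<in> B \<Longrightarrow> b \<subseteq> V"
  shows "cross_free_set m (f ` V) ((`) f ` B) (f ` X1) (f ` X2) (f ` X3)"
proof -
  note cf = assms(1)[unfolded cross_free_set_def]
  have card: "card (f ` X) = card X" if "X \<subseteq> V" for X
    using card_image inj_on_subset[OF inj] that by blast
  have "card (f ` b \<inter> f ` X) = card (b \<inter> X)" if "b \<in> B" "X \<subseteq> V" for b X
    using inj_on_image_Int[OF inj sub[OF that(1)] that(2)] card[of "b \<inter> X"] that(2)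
    by (metis inf.coboundedI2)
  moreover have "f ` X \<inter> f ` Y = {}" if "X \<subseteq> V" "Y \<subseteq> V" "X \<inter> Y = {}" for X Y
    using inj_on_image_Int[OF inj that(1,2)] that(3) by simp
  ultimately show ?thesis
    using cf card unfolding cross_free_set_def by auto
qed

section \<open>Upper bound by counting and parity\<close>

lemma cross_free_set_size_bound:
  assumes "steiner_triple_system n V B" "cross_free_set m V B X1 X2 X3"
  shows "3 * m \<le> n"
proof -
  have "card (X1 \<union> X2 \<union> X3) = 3 * m"
    using assms(2) unfolding cross_free_set_def by (simp add: card_Un_disjoint Int_Un_distrib2)
  moreover have "card (X1 \<union> X2 \<union> X3) \<le> card V"
    using assms unfolding steiner_triple_system_def cross_free_set_def by (intro card_mono) auto
  ultimately show ?thesis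
    using assms(1) unfolding steiner_triple_system_def by simp
qed

lemma cross_free_partition_even:
  assumes sts: "steiner_triple_system (3 * m) V B" and cf: "cross_free_set m V B X1 X2 X3"
  shows "even m"
proof -
  note S = sts[unfolded steiner_triple_system_def] and C = cf[unfolded cross_free_set_def]
  have "card (X1 \<union> X2 \<union> X3) = card V"
    using S C by (simp add: card_Un_disjoint Int_Un_distrib2)
  \<comment> \<open>Three disjoint sets of size \<open>m\<close> inside \<open>3 * m\<close> points
    leave no point over.\<close>
  then have V: "V = X1 \<union> X2 \<union> X3"
    using S C by (metis card_subset_eq Un_least)
  define P where "P b = (b \<inter> X1) \<times> (b \<inter> X2)" for b
  have "B \<subseteq> Pow V" using S by blast
  then have finB: "finite B" using S by (metis finite_Pow_iff finite_subset)
  have "X1 \<times> X2 = (\<Union>b\<in>B. P b)"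
  proof
    show "X1 \<times> X2 \<subseteq> (\<Union>b\<in>B. P b)"
    proof clarify
      fix x y assume xy: "x \<in> X1" "y \<in> X2"
      then have "x \<in> V" "y \<in> V" "x \<noteq> y" using C by auto
      then obtain b where "b \<in> B" "x \<in> b" "y \<in> b" using S by metis
      then show "(x, y) \<in> (\<Union>b\<in>B. P b)" using xy by (auto simp: P_def)
    qed
  qed (auto simp: P_def)
  moreover have "card (\<Union>b\<in>B. P b) = (\<Sum>b\<in>B. card (P b))"
  proof (rule card_UN_disjoint[OF finB])
    show "\<forall>b\<in>B. finite (P b)" using C by (simp add: P_def)
    show "\<forall>b\<in>B. \<forall>c\<in>B. b \<noteq> c \<longrightarrow> P b \<inter> P c = {}"
    proof (intro ballI impI equals0I)
      fix b c p assume bc: "b \<in> B" "c \<in> B" "b \<noteq> c" "p \<in> P b \<inter> P c"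
      then obtain x y where "x \<in> b" "x \<in> c" "y \<in> b" "y \<in> c" "x \<in> X1" "y \<in> X2"
        by (auto simp: P_def)
      moreover from this have "x \<in> V" "y \<in> V" "x \<noteq> y" using C by auto
      ultimately show False using S bc by metis
    qed
  qed
  moreover have "even (card (P b))" if b: "b \<in> B" for b
  proof -
    have "b = (b \<inter> X1) \<union> (b \<inter> X2) \<union> (b \<inter> X3)" using S V b by blast
    moreover have "card ((b \<inter> X1) \<union> (b \<inter> X2) \<union> (b \<inter> X3)) =
        card (b \<inter> X1) + card (b \<inter> X2) + card (b \<inter> X3)"
      using C by (subst card_Un_disjoint, simp, simp, blast)+ simp
    ultimately have "card (b \<inter> X1) + card (b \<inter> X2) + card (b \<inter> X3) = 3" using S b by metis
    moreover have "\<not> (card (b \<inter> X1) = 1 \<and> card (b \<inter> X2) = 1 \<and> card (b \<inter> X3) = 1)"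
      using C b by blast
    \<comment> \<open>If the first two parts were both odd, a sum of 3 would force the excluded type
      (1, 1, 1).\<close>
    ultimately have "card (b \<inter> X1) = 0 \<or> card (b \<inter> X2) = 0 \<or> even (card (b \<inter> X1)) \<or> even (card (b \<inter> X2))"
      by presburger
    then show ?thesis by (auto simp: P_def card_cartesian_product)
  qed
  ultimately have "even (card (X1 \<times> X2))" by (simp add: dvd_sum)
  then show ?thesis using C by (simp add: card_cartesian_product)
qed

section \<open>Group divisible designs and the Bose construction\<close>

text \<open>The affine plane of order 3, its points read row by row from a 3 by 3 grid. Every line
  that is not a row has one point in each row, which gives the last clause. Uniqueness of lines is
  evaluated on numerals and transported along \<open>?f\<close>.\<close>

lemma steiner_triple_system_9:
  assumes "distinct [a, b, c, d, e, f, g, h, i]"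
  obtains B where "steiner_triple_system 9 {a, b, c, d, e, f, g, h, i} B" "{a, b, c} \<in> B"
    "\<And>l. l \<in> B \<Longrightarrow> l \<inter> {a, b, c} = {} \<Longrightarrow> l = {d, e, f} \<or> l = {g, h, i}"
proof -
  define V :: "nat set" where "V = {0,1,2,3,4,5,6,7,8}"
  define B :: "nat set set" where "B = {{0,1,2},{3,4,5},{6,7,8},{0,3,6},{1,4,7},{2,5,8},
             {0,4,8},{1,5,6},{2,3,7},{0,5,7},{1,3,8},{2,4,6}}"
  let ?f = "\<lambda>n. [a, b, c, d, e, f, g, h, i] ! n"
  have pairs: "\<forall>x\<in>V. \<forall>y\<in>V. x \<noteq> y \<longrightarrow>
      (\<exists>l\<in>B. x \<in> l \<and> y \<in> l \<and> (\<forall>l'\<in>B. x \<in> l' \<and> y \<in> l' \<longrightarrow> l' = l))"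
    unfolding V_def B_def by code_simp
  have "steiner_triple_system 9 V B"
    unfolding steiner_triple_system_def
  proof (intro conjI ballI impI)
    show "finite V" "card V = 9" by (simp_all add: V_def)
    show "l \<subseteq> V" "card l = 3" if "l \<in> B" for l
      using that by (auto simp: B_def V_def)
    fix x y assume "x \<in> V" "y \<in> V" "x \<noteq> y"
    with pairs obtain l where "l \<in> B" "x \<in> l" "y \<in> l"
      "\<And>l'. l' \<in> B \<Longrightarrow> x \<in> l' \<Longrightarrow> y \<in> l' \<Longrightarrow> l' = l" by meson
    then show "\<exists>!l. l \<in> B \<and> x \<in> l \<and> y \<in> l" by blast
  qed
  moreover have "inj_on ?f V"
    by (rule inj_on_nth[OF assms]) (simp add: V_def)
  ultimately have "steiner_triple_system 9 (?f ` V) ((`) ?f ` B)"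
    by (rule steiner_triple_system_image)
  moreover have "?f ` V = {a, b, c, d, e, f, g, h, i}" by (simp add: V_def)
  moreover have "(`) ?f ` B = {{a,b,c},{d,e,f},{g,h,i},{a,d,g},{b,e,h},{c,f,i},
             {a,e,i},{b,f,g},{c,d,h},{a,f,h},{b,d,i},{c,e,g}}" by (simp add: B_def)
  ultimately show ?thesis
    by (intro that[of "(`) ?f ` B"]) auto
qed

text \<open>\<open>L\<close> is a group divisible design whose groups are the fibres of
  \<open>g\<close>. Two fillings share only the points of \<open>I\<close>, and hence only the block
  \<open>I\<close>, so pairs inside \<open>I\<close> are not covered twice.\<close>

lemma steiner_triple_system_fill_groups:
  assumes fin: "finite W" "W \<noteq> {}" "finite I" and disj: "W \<inter> I = {}"
    and L: "\<And>b. b \<in> L \<Longrightarrow> b \<subseteq> W \<and> card b = 3 \<and> inj_on g b"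
    and L1: "\<And>x y. x \<in> W \<Longrightarrow> y \<in> W \<Longrightarrow> g x \<noteq> g y \<Longrightarrow> \<exists>!b. b \<in> L \<and> x \<in> b \<and> y \<in> b"
    and F: "\<And>j. j \<in> g ` W \<Longrightarrow> steiner_triple_system (m j) ({x \<in> W. g x = j} \<union> I) (F j)"
    and FI: "\<And>j. j \<in> g ` W \<Longrightarrow> I \<in> F j"
  shows "steiner_triple_system (card W + card I) (W \<union> I) (L \<union> (\<Union>j\<in>g ` W. F j))"
    (is "steiner_triple_system _ _ ?B")
proof -
  have F3: "b \<subseteq> {x \<in> W. g x = j} \<union> I" "card b = 3" if "j \<in> g ` W" "b \<in> F j" for j b
    using F[OF that(1)] that(2) unfolding steiner_triple_system_def by auto
  have F1: "\<exists>!b. b \<in> F j \<and> x \<in> b \<and> y \<in> b"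
    if "j \<in> g ` W" "x \<in> {x \<in> W. g x = j} \<union> I" "y \<in> {x \<in> W. g x = j} \<union> I" "x \<noteq> y" for j x y
    using F[OF that(1)] that(2-4) unfolding steiner_triple_system_def by blast
  have I_only: "b = I" if "j \<in> g ` W" "b \<in> F j" "x \<in> b" "y \<in> b" "x \<in> I" "y \<in> I" "x \<noteq> y" for j b x y
    using F1[OF that(1), of x y] FI[OF that(1)] that by blast
  have group: "\<exists>!b. b \<in> ?B \<and> x \<in> b \<and> y \<in> b"
    if x: "x \<in> W" and y: "y \<in> {z \<in> W. g z = g x} \<union> I" and "x \<noteq> y" for x y
  proof -
    have j: "g x \<in> g ` W" using x by blast
    \<comment> \<open>A transversal block has neither a second point in the group of
      \<open>x\<close> nor a point of \<open>I\<close>; a filling of another group misses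
      \<open>x\<close>.\<close>
    have "b \<in> F (g x)" if b: "b \<in> ?B" "x \<in> b" "y \<in> b" for b
      using b
    proof (elim UnE UN_E)
      assume "b \<in> L"
      then have "y \<in> W" "inj_on g b" using L b by blast+
      then show ?thesis using b x y \<open>x \<noteq> y\<close> disj by (auto dest: inj_onD)
    next
      fix k assume "k \<in> g ` W" "b \<in> F k"
      then show ?thesis using F3[of k b] b x disj by auto
    qed
    moreover have "F (g x) \<subseteq> ?B" using j by blast
    ultimately show ?thesis
      using F1[OF j, of x y] x y \<open>x \<noteq> y\<close> by (smt (verit) UnI1 mem_Collect_eq subset_eq)
  qed
  show ?thesis
    unfolding steiner_triple_system_def
  proof (intro conjI ballI impI)
    show "finite (W \<union> I)" "card (W \<union> I) = card W + card I"
      using fin disj by (auto simp: card_Un_disjoint)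
    have "b \<subseteq> W \<union> I \<and> card b = 3" if "b \<in> ?B" for b
      using that
    proof (elim UnE UN_E)
      assume "b \<in> L"
      then show ?thesis using L by blast
    next
      fix j assume "j \<in> g ` W" "b \<in> F j"
      then show ?thesis using F3[of j b] by blast
    qed
    then show "b \<subseteq> W \<union> I" "card b = 3" if "b \<in> ?B" for b
      using that by blast+
    fix x y assume x: "x \<in> W \<union> I" and y: "y \<in> W \<union> I" and "x \<noteq> y"
    consider "x \<in> W" "y \<in> W" "g x \<noteq> g y" | "x \<in> W" "y \<in> {z \<in> W. g z = g x} \<union> I"
      | "x \<in> I" "y \<in> W" | "x \<in> I" "y \<in> I"
      using x y by (cases "g x = g y") auto
    then show "\<exists>!b. b \<in> ?B \<and> x \<in> b \<and> y \<in> b"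
    proof cases
      case 1
      have "b \<in> L" if "b \<in> ?B" "x \<in> b" "y \<in> b" for b
        using that(1)
      proof (elim UnE UN_E)
        fix j assume "j \<in> g ` W" "b \<in> F j"
        then have "x \<in> {x \<in> W. g x = j} \<union> I" "y \<in> {x \<in> W. g x = j} \<union> I"
          using F3(1)[of j b] that by auto
        then show ?thesis using 1 disj by auto
      qed
      then show ?thesis using L1[OF 1] by (smt (verit) UnI1)
    next
      case 2
      then show ?thesis using \<open>x \<noteq> y\<close> by (rule group)
    next
      case 3
      then have "\<exists>!b. b \<in> ?B \<and> y \<in> b \<and> x \<in> b" 
        using \<open>x \<noteq> y\<close> by (intro group) auto
      then show ?thesis by (simp add: conj_commute)
    next
      case 4
      \<comment> \<open>Some group must exist for \<open>I\<close> to be a block at all.\<close>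
      obtain j where j: "j \<in> g ` W" using fin by blast
      show ?thesis
      proof (rule ex1I[of _ I])
        show "I \<in> ?B \<and> x \<in> I \<and> y \<in> I" using 4 j FI by blast
        show "b = I" if "b \<in> ?B \<and> x \<in> b \<and> y \<in> b" for b
        proof -
          from that have "b \<in> ?B" "x \<in> b" "y \<in> b" by auto
          from \<open>b \<in> ?B\<close> show ?thesis
          proof (elim UnE UN_E)
            assume "b \<in> L"
            then show ?thesis using L[of b] 4 disj \<open>x \<in> b\<close> by auto
          next
            fix j assume "j \<in> g ` W" "b \<in> F j"
            then show ?thesis using I_only 4 \<open>x \<in> b\<close> \<open>y \<in> b\<close> \<open>x \<noteq> y\<close> by metis
          qed
        qed
      qed
    qed
  qed
qed

section \<open>Bose blocks over a commutative quasigroup with holes\<close>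

lemma less_3_cases:
  fixes i :: nat
  assumes "i < 3"
  shows "i = 0 \<or> i = 1 \<or> i = 2"
  using assms by linarith

lemma Suc_mod_3_neq: "Suc i mod 3 \<noteq> i" "i < 3 \<Longrightarrow> Suc (Suc i mod 3) mod 3 \<noteq> i"
  by presburger+

locale holey_commutative_quasigroup =
  fixes Q :: "'a set" and g :: "'a \<Rightarrow> 'b" and p :: "'a \<Rightarrow> 'a \<Rightarrow> 'a"
  assumes finite_Q: "finite Q"
    and p_closed: "x \<in> Q \<Longrightarrow> y \<in> Q \<Longrightarrow> g x \<noteq> g y \<Longrightarrow> p x y \<in> Q"
    and p_hole: "x \<in> Q \<Longrightarrow> y \<in> Q \<Longrightarrow> g x \<noteq> g y \<Longrightarrow> g (p x y) \<noteq> g x"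
    and p_commute: "x \<in> Q \<Longrightarrow> y \<in> Q \<Longrightarrow> g x \<noteq> g y \<Longrightarrow> p x y = p y x"
    and p_cancel: "x \<in> Q \<Longrightarrow> y \<in> Q \<Longrightarrow> z \<in> Q \<Longrightarrow> g x \<noteq> g y \<Longrightarrow> g x \<noteq> g z \<Longrightarrow> p x y = p x z \<Longrightarrow> y = z"
begin

text \<open>Multiplication by \<open>x\<close> maps the complement of its hole injectively into
  itself; as this set is finite, the map is onto.\<close>

lemma p_solve:
  assumes "x \<in> Q" "s \<in> Q" "g x \<noteq> g s"
  obtains y where "y \<in> Q" "g x \<noteq> g y" "p x y = s"
proof -
  let ?R = "{y \<in> Q. g x \<noteq> g y}"
  have "p x ` ?R \<subseteq> ?R"
  proof (rule image_subsetI)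
    fix y assume "y \<in> ?R"
    then show "p x y \<in> ?R" using p_closed[of x y] p_hole[of x y] assms(1) by auto
  qed
  moreover have "inj_on (p x) ?R" using p_cancel[OF assms(1)] by (auto intro!: inj_onI)
  ultimately have "p x ` ?R = ?R" using finite_Q by (intro endo_inj_surj) auto
  then have "s \<in> p x ` ?R" using assms by blast
  then show ?thesis using that by blast
qed

definition bose_block :: "'a \<Rightarrow> 'a \<Rightarrow> nat \<Rightarrow> ('a \<times> nat) set" where
  "bose_block x y i = {(x, i), (y, i), (p x y, Suc i mod 3)}"

definition bose_blocks :: "('a \<times> nat) set set" where
  "bose_blocks = {bose_block x y i | x y i. x \<in> Q \<and> y \<in> Q \<and> g x \<noteq> g y \<and> i < 3}"

lemma bose_block_commute:
  "x \<in> Q \<Longrightarrow> y \<in> Q \<Longrightarrow> g x \<noteq> g y \<Longrightarrow> bose_block x y i = bose_block y x i"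
  unfolding bose_block_def using p_commute by auto

lemma bose_blocks_same_level:
  assumes "b \<in> bose_blocks" "(x, i) \<in> b" "(y, i) \<in> b" "x \<noteq> y"
  shows "b = bose_block x y i"
proof -
  obtain u v l where uv: "u \<in> Q" "v \<in> Q" "g u \<noteq> g v" "b = bose_block u v l"
    using assms(1) unfolding bose_blocks_def by blast
  then have "i = l" "x = u \<and> y = v \<or> x = v \<and> y = u"
    using assms(2-4) Suc_mod_3_neq(1)[of l] unfolding bose_block_def by auto
  then show ?thesis using uv bose_block_commute by metis
qed

lemma bose_blocks_next_level:
  assumes "b \<in> bose_blocks" "(x, i) \<in> b" "(s, Suc i mod 3) \<in> b"
  obtains z where "z \<in> Q" "g x \<noteq> g z" "p x z = s" "b = bose_block x z i"
proof -
  obtain u v l where uv: "u \<in> Q" "v \<in> Q" "g u \<noteq> g v" "b = bose_block u v l" "l < 3"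
    using assms(1) unfolding bose_blocks_def by blast
  \<comment> \<open>The block occupies levels \<open>l\<close> and \<open>l + 1\<close> only. Since
    \<open>l + 2\<close> differs from \<open>l\<close> modulo 3, the lower of the two consecutive
    levels must be \<open>l\<close>.\<close>
  then have "i = l" "s = p u v" "x = u \<or> x = v"
    using assms(2-3) Suc_mod_3_neq(1)[of l] Suc_mod_3_neq(1)[of i] Suc_mod_3_neq(2)[of l]
    unfolding bose_block_def by auto
  then show ?thesis
    using uv that[of v] that[of u] bose_block_commute p_commute by metis
qed

lemma bose_blocks_ex1:
  assumes "x \<in> Q" "y \<in> Q" "g x \<noteq> g y" "i < 3" "j < 3"
  shows "\<exists>!b. b \<in> bose_blocks \<and> (x, i) \<in> b \<and> (y, j) \<in> b"
proof -
  have next_level: "\<exists>!b. b \<in> bose_blocks \<and> (u, l) \<in> b \<and> (v, Suc l mod 3) \<in> b"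
    if uv: "u \<in> Q" "v \<in> Q" "g u \<noteq> g v" "l < 3" for u v l
  proof -
    \<comment> \<open>A pair on consecutive levels determines its block by solving the quasigroup
      equation for the second point on the lower level.\<close>
    obtain z where z: "z \<in> Q" "g u \<noteq> g z" "p u z = v" using p_solve uv by metis
    show ?thesis
    proof (rule ex1I[of _ "bose_block u z l"])
      show "bose_block u z l \<in> bose_blocks \<and> (u, l) \<in> bose_block u z l \<and> (v, Suc l mod 3) \<in> bose_block u z l"
        using z uv unfolding bose_blocks_def bose_block_def by blast
      show "b = bose_block u z l" if "b \<in> bose_blocks \<and> (u, l) \<in> b \<and> (v, Suc l mod 3) \<in> b" for b
        using that z uv p_cancel bose_blocks_next_level by metis
    qed
  qed
  have "i = j \<or> j = Suc i mod 3 \<or> i = Suc j mod 3" 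
    using less_3_cases[OF assms(4)] less_3_cases[OF assms(5)] by auto
  then consider "i = j" | "j = Suc i mod 3" | "i = Suc j mod 3" by blast
  then show ?thesis
  proof cases
    case 1
    show ?thesis
    proof (rule ex1I[of _ "bose_block x y i"])
      show "bose_block x y i \<in> bose_blocks \<and> (x, i) \<in> bose_block x y i \<and> (y, j) \<in> bose_block x y i"
        using assms 1 unfolding bose_blocks_def bose_block_def by blast
      show "b = bose_block x y i" if "b \<in> bose_blocks \<and> (x, i) \<in> b \<and> (y, j) \<in> b" for b
        using that bose_blocks_same_level 1 assms(3) by metis
    qed
  next
    case 2
    then show ?thesis using next_level[of x y i] assms by simp
  next
    case 3
    then have "\<exists>!b. b \<in> bose_blocks \<and> (y, j) \<in> b \<and> (x, i) \<in> b"
      using next_level[of y x j] assms by simp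
    then show ?thesis by (simp add: conj_commute)
  qed
qed

lemma bose_blocks_wf:
  assumes "b \<in> bose_blocks"
  shows "b \<subseteq> Q \<times> {..<3} \<and> card b = 3 \<and> inj_on (g \<circ> fst) b"
proof -
  obtain u v l where uv: "u \<in> Q" "v \<in> Q" "g u \<noteq> g v" "b = bose_block u v l" "l < 3"
    using assms(1) unfolding bose_blocks_def by blast
  have "p u v \<in> Q" "g (p u v) \<noteq> g u" "g (p u v) \<noteq> g v"
    using uv p_closed p_hole p_commute by metis+
  moreover from this have "p u v \<noteq> u" "p u v \<noteq> v" "u \<noteq> v" using uv by auto
  ultimately show ?thesis using uv unfolding bose_block_def by (auto simp: inj_on_def)
qed

lemma bose_blocks_not_rainbow:
  assumes "b \<in> bose_blocks"
  shows "\<exists>i<3. card (b \<inter> Q \<times> {i}) \<noteq> 1"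
proof -
  obtain u v l where uv: "u \<in> Q" "v \<in> Q" "g u \<noteq> g v" "b = bose_block u v l" "l < 3"
    using assms(1) unfolding bose_blocks_def by blast
  then have "b \<inter> Q \<times> {l} = {(u, l), (v, l)}"
    using Suc_mod_3_neq(1)[of l] unfolding bose_block_def by auto
  moreover have "u \<noteq> v" using uv by auto
  ultimately show ?thesis using uv(5) by (intro exI[of _ l]) auto
qed

end

section \<open>A commutative quasigroup with holes of size 2\<close>

text \<open>
  The quasigroup lives on the integers modulo \<open>2N\<close>, with holes \<open>{x, x + N}\<close>, together with two infinite
  elements, encoded as \<open>2N\<close> and \<open>2N + 1\<close>, that form one more hole. It is developed modulo \<open>2N\<close>
  from the starter consisting of the pairs \<open>{i, -i}\<close> with even differences \<open>2i < N\<close>, the pairs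
  \<open>{N + 1 + i, N - i}\<close> with odd differences \<open>2i + 1 < N\<close>, \<open>i \<ge> 1\<close>, and the two elements left over,
  \<open>(N + 1) div 2\<close> and \<open>N + 1\<close>, which are paired with the infinite elements. The remaining
  differences \<open>1\<close> and \<open>-1\<close> form a cycle of length \<open>2N\<close>, whose edges are alternately given the two
  infinite products.
\<close>

definition hole :: "int \<Rightarrow> int \<Rightarrow> int" where
  "hole N x = (if x \<ge> 2 * N then N else x mod N)"

text \<open>For positive \<open>N\<close>, the representative of \<open>x - y\<close> modulo
  \<open>2 * N\<close> in the half-open window from \<open>- N\<close> to \<open>N\<close>, with
  \<open>N\<close> excluded.\<close>

definition cdiff :: "int \<Rightarrow> int \<Rightarrow> int \<Rightarrow> int" where
  "cdiff N x y = (x - y + N) mod (2 * N) - N"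

text \<open>The left element of the ordered starter pair with difference \<open>d\<close>, for \<open>d\<close> between \<open>-N\<close> and \<open>N\<close>.\<close>
definition starter :: "int \<Rightarrow> int \<Rightarrow> int" where
  "starter N d = (if even d then d div 2 else N + (d + 1) div 2)"

text \<open>The starter element of which a finite \<open>x\<close> is a translate when
  \<open>y\<close> is its partner; the first two cases are the elements paired with
  infinity.\<close>

definition shift :: "int \<Rightarrow> int \<Rightarrow> int \<Rightarrow> int" where
  "shift N x y = (if y = 2 * N then (N + 1) div 2 else if y = 2 * N + 1 then N + 1
                  else starter N (cdiff N x y))"

definition adjacent :: "int \<Rightarrow> int \<Rightarrow> int \<Rightarrow> bool" where
  "adjacent N x y \<longleftrightarrow> x < 2 * N \<and> y < 2 * N \<and> \<bar>cdiff N x y\<bar> = 1"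

text \<open>Away from the cycle, the product is the translation carrying the starter pair to
  \<open>{x, y}\<close>. An edge of the cycle gets the infinite element given by the parity of its
  initial vertex \<open>v\<close>, where the edge joins \<open>v\<close> and \<open>v + 1\<close>
  modulo \<open>2 * N\<close>.\<close>

definition hprod :: "int \<Rightarrow> int \<Rightarrow> int \<Rightarrow> int" where
  "hprod N x y =
    (if adjacent N x y then 2 * N + (if cdiff N x y = 1 then y else x) mod 2
     else if x < 2 * N then (x - shift N x y) mod (2 * N)
     else (y - shift N y x) mod (2 * N))"

section \<open>Arithmetic of differences modulo \<open>2 * N\<close>\<close>

lemma mod_eq_imp_eq:
  fixes a b M :: int
  assumes "a mod M = b mod M" "\<bar>a - b\<bar> < M"
  shows "a = b"
  using assms dvd_imp_le_int[of "a - b" M] by (force simp: mod_eq_dvd_iff)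

lemma cdiff_unique:
  assumes "- N \<le> d" "d < N" "2 * N dvd x - y - d"
  shows "cdiff N x y = d"
proof -
  obtain c where c: "x - y - d = 2 * N * c" using assms(3) by (rule dvdE)
  then have "x - y + N = (d + N) + 2 * N * c" by simp
  then have "(x - y + N) mod (2 * N) = (d + N) mod (2 * N)" by (metis mod_mult_self2)
  also have "\<dots> = d + N" using assms by (intro mod_pos_pos_trivial) auto
  finally show ?thesis by (simp add: cdiff_def)
qed

lemma cdiff_dvd: "2 * N dvd x - y - cdiff N x y"
proof -
  have "2 * N dvd (x - y + N) - (x - y + N) mod (2 * N)" by (simp add: minus_mod_eq_mult_div)
  then show ?thesis by (simp add: cdiff_def algebra_simps)
qed

lemma cdiff_bounds: "N > 0 \<Longrightarrow> - N \<le> cdiff N x y \<and> cdiff N x y < N"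
  unfolding cdiff_def by (smt (verit) pos_mod_bound pos_mod_sign)

text \<open>\<open>cdiff N x y\<close> differs from \<open>x - y\<close> by a multiple of
  \<open>2 * N\<close>, and 0 and \<open>- N\<close> are the only multiples of \<open>N\<close> in
  its window.\<close>

lemma hole_eq_iff:
  assumes "N > 0" "0 \<le> x" "x < 2 * N" "0 \<le> y" "y < 2 * N"
  shows "hole N x = hole N y \<longleftrightarrow> cdiff N x y \<in> {0, - N}"
proof -
  have "hole N x = hole N y \<longleftrightarrow> N dvd x - y"
    using assms by (simp add: hole_def mod_eq_dvd_iff)
  also have "\<dots> \<longleftrightarrow> N dvd cdiff N x y"
  proof -
    obtain c where "x - y - cdiff N x y = 2 * N * c" using cdiff_dvd[of N x y] ..
    then have "x - y = cdiff N x y + (2 * c) * N" by (simp add: algebra_simps)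
    then show ?thesis by (simp only: dvd_add_times_triv_right_iff)
  qed
  also have "\<dots> \<longleftrightarrow> cdiff N x y \<in> {0, - N}"
  proof
    assume "N dvd cdiff N x y"
    then obtain c where c: "cdiff N x y = N * c" ..
    then have "N * (- 1) \<le> N * c" "N * c < N * 1" using cdiff_bounds[OF assms(1), of x y] by auto
    then have "- 1 \<le> c" "c < 1" using assms(1) by (simp_all only: mult_le_cancel_left_pos mult_less_cancel_left_pos)
    then have "c = 0 \<or> c = - 1" by auto
    then show "cdiff N x y \<in> {0, - N}" using c by auto
  qed auto
  finally show ?thesis .
qed

lemma cdiff_minus:
  assumes "N > 0" "cdiff N x y \<noteq> - N"
  shows "cdiff N y x = - cdiff N x y"
proof (rule cdiff_unique)
  show "2 * N dvd y - x - - cdiff N x y"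
    using cdiff_dvd[of N x y] by (simp add: dvd_diff_commute algebra_simps)
qed (use assms cdiff_bounds[of N x y] in auto)

text \<open>Reversing an ordered starter pair makes its right element \<open>starter N d - d\<close>
  the left one; this is what makes the product commutative.\<close>

lemma starter_minus: "starter N (- d) = starter N d - d"
  unfolding starter_def by presburger

section \<open>The quasigroup laws for \<open>hprod\<close>\<close>

lemma hprod_commute:
  assumes "N > 0" "x \<in> {0..<2*N+2}" "y \<in> {0..<2*N+2}" "hole N x \<noteq> hole N y"
  shows "hprod N x y = hprod N y x"
proof (cases "x < 2 * N \<and> y < 2 * N")
  case True
  let ?d = "cdiff N x y"
  have d: "?d \<noteq> - N" using True assms hole_eq_iff[of N x y] by auto
  note m = cdiff_minus[OF assms(1) d]
  have "2 * N dvd (x - starter N ?d) - (y - starter N (- ?d))"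
    using cdiff_dvd[of N x y] by (simp add: starter_minus algebra_simps)
  then show ?thesis
    using True m by (auto simp: hprod_def adjacent_def shift_def mod_eq_dvd_iff)
next
  case False
  then show ?thesis using assms by (auto simp: hprod_def adjacent_def hole_def)
qed

text \<open>The four alternatives occupy disjoint sets of shifts, and in the last two the shift
  determines the difference. So the shift identifies the partner of \<open>x\<close>.\<close>

lemma shift_cases:
  assumes "N \<ge> 2" "0 \<le> x" "x < 2 * N" "y \<in> {0..<2*N+2}" "hole N x \<noteq> hole N y" "\<not> adjacent N x y"
  shows "y = 2 * N \<and> (2 * shift N x y = N \<or> 2 * shift N x y = N + 1) \<or>
    y = 2 * N + 1 \<and> shift N x y = N + 1 \<or>
    y < 2 * N \<and> shift N x y \<noteq> 0 \<and> cdiff N x y = 2 * shift N x y \<and> \<bar>2 * shift N x y\<bar> < N \<or>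
    y < 2 * N \<and> shift N x y \<noteq> N \<and> shift N x y \<noteq> N + 1 \<and> cdiff N x y = 2 * (shift N x y - N) - 1
      \<and> N + 2 \<le> 2 * shift N x y \<and> 2 * shift N x y \<le> 3 * N"
proof (cases "y < 2 * N")
  case True
  let ?d = "cdiff N x y"
  have "?d \<noteq> 0" "?d \<noteq> - N" using True assms hole_eq_iff[of N x y] by auto
  moreover have "\<bar>?d\<bar> \<noteq> 1" using True assms by (simp add: adjacent_def)
  moreover have "- N \<le> ?d" "?d < N" using cdiff_bounds[of N x y] assms by auto
  moreover have "shift N x y = starter N ?d" using True by (simp add: shift_def)
  ultimately show ?thesis using True unfolding starter_def by (cases "even ?d") (auto elim!: evenE oddE)
next
  case False
  then have "y = 2 * N \<or> y = 2 * N + 1" using assms by auto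
  then show ?thesis by (auto simp: shift_def)
qed

text \<open>All shifts lie in one window of length \<open>2 * N\<close>, so they are distinguished
  by their residues; the omitted values 0 and \<open>N\<close> form the hole at the origin.\<close>

lemma shift_bounds:
  assumes "N \<ge> 2" "0 \<le> x" "x < 2 * N" "y \<in> {0..<2*N+2}" "hole N x \<noteq> hole N y" "\<not> adjacent N x y"
  shows "- N < 2 * shift N x y" "2 * shift N x y \<le> 3 * N" "shift N x y \<noteq> 0" "shift N x y \<noteq> N"
  using shift_cases[OF assms] assms(1) by auto

lemma cdiff_cancel:
  assumes "cdiff N x y = cdiff N x z" "0 \<le> y" "y < 2 * N" "0 \<le> z" "z < 2 * N"
  shows "y = z"
proof (rule mod_eq_imp_eq)
  have "2 * N dvd (x - z - cdiff N x z) - (x - y - cdiff N x y)"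
    using cdiff_dvd by (rule dvd_diff) (rule cdiff_dvd)
  then show "y mod (2 * N) = z mod (2 * N)" by (simp add: assms(1) mod_eq_dvd_iff)
qed (use assms in auto)

lemma shift_cancel:
  assumes "N \<ge> 2" "0 \<le> x" "x < 2 * N" "y \<in> {0..<2*N+2}" "hole N x \<noteq> hole N y" "\<not> adjacent N x y"
    "z \<in> {0..<2*N+2}" "hole N x \<noteq> hole N z" "\<not> adjacent N x z" "shift N x y = shift N x z"
  shows "y = z"
  using shift_cases[OF assms(1-6)] shift_cases[OF assms(1-3,7-9)] assms(1,4,7,10)
    cdiff_cancel[of N x y z] unfolding atLeastLessThan_iff
  by (smt (verit))

lemma hprod_closed:
  assumes "N \<ge> 2" "x \<in> {0..<2*N+2}" "y \<in> {0..<2*N+2}" "hole N x \<noteq> hole N y"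
  shows "hprod N x y \<in> {0..<2*N+2}" "hole N (hprod N x y) \<noteq> hole N x"
proof -
  have r: "0 \<le> t mod (2 * N)" "t mod (2 * N) < 2 * N" for t using assms by auto
  show "hprod N x y \<in> {0..<2*N+2}"
    unfolding hprod_def using r[of "x - shift N x y"] r[of "y - shift N y x"] assms(1)
    by (smt (verit) atLeastLessThan_iff pos_mod_bound pos_mod_sign)
  show "hole N (hprod N x y) \<noteq> hole N x"
  proof (cases "x < 2 * N")
    case x: True
    show ?thesis
    proof (cases "adjacent N x y")
      case True
      \<comment> \<open>The infinite hole carries the label \<open>N\<close>, finite holes carry
        smaller labels.\<close>
      then have "hole N (hprod N x y) = N" using assms(1) by (simp add: hprod_def hole_def)
      moreover have "hole N x < N" using x assms(1) by (simp add: hole_def)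
      ultimately show ?thesis by simp
    next
      case False
      let ?s = "shift N x y"
      \<comment> \<open>Subtracting the shift stays in the hole of \<open>x\<close> only if
        \<open>N\<close> divides it, and 0 and \<open>N\<close> are the only multiples of
        \<open>N\<close> in the window.\<close>
      have "\<not> N dvd ?s"
      proof
        assume "N dvd ?s"
        then obtain c where c: "?s = N * c" ..
        have "- N < 2 * ?s" "2 * ?s \<le> 3 * N" "?s \<noteq> 0" "?s \<noteq> N"
          using shift_bounds[of N x y] False x assms by auto
        moreover have "N * (2 * c) = 2 * ?s" using c by simp
        moreover have "c \<noteq> 0" "c \<noteq> 1" using c calculation by auto
        ultimately have "N * (-1) < N * (2 * c)" "N * (2 * c) \<le> N * 3"
          by linarith+
        then have "-1 < 2 * c" "2 * c \<le> 3"
          using assms(1) by (simp_all only: mult_le_cancel_left_pos mult_less_cancel_left_pos)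
        with \<open>c \<noteq> 0\<close> \<open>c \<noteq> 1\<close> show False by presburger
      qed
      then have "\<not> N dvd (x - ?s) mod (2 * N) - x"
      proof -
        define q where "q = (x - ?s) div (2 * N)"
        have "(x - ?s) mod (2 * N) - x = - (?s + (2 * q) * N)"
          by (simp add: q_def minus_mult_div_eq_mod[symmetric] algebra_simps)
        with \<open>\<not> N dvd ?s\<close> show ?thesis by (simp only: dvd_minus_iff dvd_add_times_triv_right_iff) simp
      qed
      then show ?thesis using False x r(2)[of "x - ?s"] by (simp add: hprod_def hole_def mod_eq_dvd_iff)
    qed
  next
    case False
    then have "hole N (hprod N x y) < N"
      using assms(1) r[of "y - shift N y x"] by (simp add: hprod_def hole_def adjacent_def not_le)
    moreover have "hole N x = N" using False by (simp add: hole_def)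
    ultimately show ?thesis by simp
  qed
qed

lemma hprod_cancel:
  assumes "N \<ge> 2" "x \<in> {0..<2*N+2}" "y \<in> {0..<2*N+2}" "z \<in> {0..<2*N+2}"
    "hole N x \<noteq> hole N y" "hole N x \<noteq> hole N z" "hprod N x y = hprod N x z"
  shows "y = z"
proof (cases "x < 2 * N")
  case x: True
  have r: "t mod (2 * N) < 2 * N" for t using assms by auto
  have big: "2 * N \<le> hprod N x t \<longleftrightarrow> adjacent N x t" for t
    using x r[of "x - shift N x t"] by (auto simp: hprod_def)
  then have "adjacent N x y \<longleftrightarrow> adjacent N x z" using assms by metis
  then consider "adjacent N x y" "adjacent N x z" | "\<not> adjacent N x y" "\<not> adjacent N x z" by blast
  then show ?thesis
  proof cases
    case 1
    \<comment> \<open>As \<open>2 * N\<close> is even, parity is well defined around the cycle. The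
      two edges at \<open>x\<close> start at vertices of opposite parity, so their products
      differ.\<close>
    have par: "even (x - t - cdiff N x t)" for t using cdiff_dvd[of N x t] by (meson dvd_mult_left)
    have "cdiff N x y = cdiff N x z"
      using 1 assms(7) par[of y] par[of z] unfolding hprod_def adjacent_def
      by (simp split: if_splits) presburger+
    moreover have "y < 2 * N" "z < 2 * N" using 1 by (simp_all add: adjacent_def)
    moreover have "0 \<le> y" "0 \<le> z" using assms(3,4) by simp_all
    ultimately show ?thesis using cdiff_cancel by blast
  next
    case 2
    have "(x - shift N x y) = (x - shift N x z)"
    proof (rule mod_eq_imp_eq)
      show "(x - shift N x y) mod (2 * N) = (x - shift N x z) mod (2 * N)"
        using assms(7) 2 x by (simp add: hprod_def)
      show "\<bar>x - shift N x y - (x - shift N x z)\<bar> < 2 * N"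
        using shift_bounds(1,2)[of N x y] shift_bounds(1,2)[of N x z] 2 x assms by auto
    qed
    then show ?thesis using shift_cancel[of N x y z] assms 2 x by auto
  qed
next
  case False
  then have yz: "y < 2 * N" "z < 2 * N" using assms by (auto simp: hole_def split: if_splits)
  have "x = 2 * N \<or> x = 2 * N + 1" using False assms(2) by auto
  \<comment> \<open>For infinite \<open>x\<close> the shift is a constant, so multiplication by
    \<open>x\<close> is a translation.\<close>
  then have "shift N y x = shift N z x" by (auto simp: shift_def)
  then have "(y - shift N y x) mod (2 * N) = (z - shift N y x) mod (2 * N)"
    using False assms(7) by (simp add: hprod_def adjacent_def)
  then have "y - shift N y x = z - shift N y x"
    by (rule mod_eq_imp_eq) (use yz assms(3,4) in auto)
  then show ?thesis by simp
qed

section \<open>The construction\<close>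

context holey_commutative_quasigroup
begin

lemma exists_cross_free_set_filling_size_2_holes:
  assumes "Q \<noteq> {}" and holes: "\<And>x. x \<in> Q \<Longrightarrow> card {y \<in> Q. g y = g x} = 2"
  shows "\<exists>(V :: ('a \<times> nat) set) B X1 X2 X3.
    steiner_triple_system (3 * card Q + 3) V B \<and> cross_free_set (card Q) V B X1 X2 X3"
proof -
  obtain q where "q \<in> Q" using assms(1) by blast
  \<comment> \<open>Levels 3, 4 and 5 over an arbitrary \<open>q\<close> supply three new points of
    the same type.\<close>
  define I where "I = {(q, 3 :: nat), (q, 4), (q, 5)}"
  define W where "W = Q \<times> {..<3 :: nat}"
  let ?g = "g \<circ> fst :: 'a \<times> nat \<Rightarrow> 'b"
  have disj: "W \<inter> I = {}" unfolding W_def I_def by auto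
  have levels: "card (l \<inter> Q \<times> {0}) + card (l \<inter> Q \<times> {1}) + card (l \<inter> Q \<times> {2}) = card (l \<inter> W)" for l
  proof -
    have "l \<inter> W = (l \<inter> Q \<times> {0}) \<union> (l \<inter> Q \<times> {1}) \<union> (l \<inter> Q \<times> {2})" unfolding W_def by auto
    moreover have "card \<dots> = card (l \<inter> Q \<times> {0}) + card (l \<inter> Q \<times> {1}) + card (l \<inter> Q \<times> {2})"
      using finite_Q by (subst card_Un_disjoint, simp, simp, force)+ simp
    ultimately show ?thesis by simp
  qed
  define filling where "filling j F \<longleftrightarrow>
      steiner_triple_system 9 ({w \<in> W. ?g w = j} \<union> I) F \<and> I \<in> F \<and>
      (\<forall>l\<in>F. \<exists>i<3. card (l \<inter> Q \<times> {i}) \<noteq> 1)" for j F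
  have "\<exists>F. filling j F" if j: "j \<in> ?g ` W" for j
  proof -
    obtain x where "x \<in> Q" "j = g x" using j unfolding W_def by auto
    then have "card {y \<in> Q. g y = j} = 2" using holes by simp
    then obtain a b where ab: "{y \<in> Q. g y = j} = {a, b}" "a \<noteq> b"
      by (auto simp: card_2_iff)
    then have Qab: "a \<in> Q" "b \<in> Q" by blast+
    have grp: "{w \<in> W. ?g w = j} = {a, b} \<times> {..<3}" unfolding W_def ab(1)[symmetric] by auto
    \<comment> \<open>This order makes \<open>I\<close> the first row and the two triples that
      repeat a level the other rows of the plane.\<close>
    have dist: "distinct [(q, 3), (q, 4), (q, 5), (a, 0), (b, 0), (a, 1), (b, 1 :: nat), (a, 2), (b, 2)]"
      using ab(2) by auto
    obtain F where F: "steiner_triple_system 9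
        {(q, 3), (q, 4), (q, 5), (a, 0), (b, 0), (a, 1), (b, 1), (a, 2), (b, 2)} F"
      and IF: "I \<in> F"
      and lines: "\<And>l. l \<in> F \<Longrightarrow> l \<inter> I = {} \<Longrightarrow>
        l = {(a, 0), (b, 0), (a, 1)} \<or> l = {(b, 1), (a, 2), (b, 2)}"
      using steiner_triple_system_9[OF dist] unfolding I_def by metis
    have "{(q, 3), (q, 4), (q, 5), (a, 0), (b, 0), (a, 1), (b, 1), (a, 2), (b, 2)} =
        {w \<in> W. ?g w = j} \<union> I"
      unfolding grp I_def by (auto simp: lessThan_nat_numeral lessThan_Suc numeral_eq_Suc)
    moreover have "\<exists>i<3. card (l \<inter> Q \<times> {i}) \<noteq> 1" if l: "l \<in> F" for l
    proof (cases "l \<inter> I = {}")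
      case True
      from lines[OF l True] show ?thesis
      proof
        assume "l = {(a, 0), (b, 0), (a, 1)}"
        then have "l \<inter> Q \<times> {0} = {(a, 0), (b, 0)}" using Qab by auto
        then show ?thesis using ab(2) by (intro exI[of _ 0]) auto
      next
        assume "l = {(b, 1), (a, 2), (b, 2)}"
        then have "l \<inter> Q \<times> {2} = {(a, 2), (b, 2)}" using Qab by auto
        then show ?thesis using ab(2) by (intro exI[of _ 2]) auto
      qed
    next
      case False
      have l3: "card l = 3" using F l unfolding steiner_triple_system_def by blast
      \<comment> \<open>A line meeting \<open>I\<close> has at most two points left for the three
        levels.\<close>
      have "card (l \<inter> W) < card l"
        using False disj l3 by (intro psubset_card_mono) (auto intro: card_ge_0_finite)
      then have "card (l \<inter> Q \<times> {0}) + card (l \<inter> Q \<times> {1}) + card (l \<inter> Q \<times> {2}) < 3"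
        using levels[of l] l3 by simp
      then have "\<not> (card (l \<inter> Q \<times> {0}) = 1 \<and> card (l \<inter> Q \<times> {1}) = 1 \<and> card (l \<inter> Q \<times> {2}) = 1)"
        by linarith
      then show ?thesis by (metis one_less_numeral_iff semiring_norm(77) zero_less_numeral lessI numeral_2_eq_2 numeral_3_eq_3)
    qed
    ultimately show ?thesis using F IF unfolding filling_def by (intro exI[of _ F]) simp
  qed
  then obtain F where filling: "\<And>j. j \<in> ?g ` W \<Longrightarrow> filling j (F j)" by metis
  then have F: "\<And>j. j \<in> ?g ` W \<Longrightarrow> steiner_triple_system 9 ({w \<in> W. ?g w = j} \<union> I) (F j)"
    and IF: "\<And>j. j \<in> ?g ` W \<Longrightarrow> I \<in> F j"
    and rainbow: "\<And>j l. j \<in> ?g ` W \<Longrightarrow> l \<in> F j \<Longrightarrow> \<exists>i<3. card (l \<inter> Q \<times> {i}) \<noteq> 1"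
    unfolding filling_def by blast+
  let ?B = "bose_blocks \<union> (\<Union>j\<in>?g ` W. F j)"
  have "steiner_triple_system (card W + card I) (W \<union> I) ?B"
  proof (rule steiner_triple_system_fill_groups[where m = "\<lambda>_. 9"])
    show "finite W" "W \<noteq> {}" "finite I"
      using finite_Q assms(1) unfolding W_def I_def by (auto simp: lessThan_empty_iff)
    show "b \<subseteq> W \<and> card b = 3 \<and> inj_on ?g b" if "b \<in> bose_blocks" for b
      using bose_blocks_wf[OF that] unfolding W_def .
    show "\<exists>!b. b \<in> bose_blocks \<and> x \<in> b \<and> y \<in> b" if "x \<in> W" "y \<in> W" "?g x \<noteq> ?g y" for x y
      using that bose_blocks_ex1[of "fst x" "fst y" "snd x" "snd y"] unfolding W_def by (simp add: mem_Times_iff)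
  qed (fact disj, erule F, erule IF)
  moreover have "card W + card I = 3 * card Q + 3" 
    unfolding W_def I_def by (simp add: card_cartesian_product)
  moreover have "cross_free_set (card Q) (W \<union> I) ?B (Q \<times> {0}) (Q \<times> {1}) (Q \<times> {2})"
  proof -
    have "\<not> (card (b \<inter> Q \<times> {0}) = 1 \<and> card (b \<inter> Q \<times> {1}) = 1 \<and> card (b \<inter> Q \<times> {2}) = 1)"
      if b: "b \<in> ?B" for b
    proof -
      obtain i :: nat where "i < 3" "card (b \<inter> Q \<times> {i}) \<noteq> 1"
        using b by (elim UnE UN_E) (use bose_blocks_not_rainbow rainbow in blast)+
      then show ?thesis using less_3_cases[of i] by auto
    qed
    then show ?thesis
      unfolding cross_free_set_def using finite_Q by (auto simp: W_def card_cartesian_product)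
  qed
  ultimately have "steiner_triple_system (3 * card Q + 3) (W \<union> I) ?B \<and>
      cross_free_set (card Q) (W \<union> I) ?B (Q \<times> {0}) (Q \<times> {1}) (Q \<times> {2})"
    by simp
  then show ?thesis by (intro exI)
qed

end

section \<open>The instance of order \<open>6 * k\<close> and the value of \<open>G\<close>\<close>

lemma holey_commutative_quasigroup_hprod:
  assumes "N \<ge> 2"
  shows "holey_commutative_quasigroup {0..<2*N+2} (hole N) (hprod N)"
proof
  fix x y z
  assume "x \<in> {0..<2*N+2}" "y \<in> {0..<2*N+2}" "hole N x \<noteq> hole N y"
  then show "hprod N x y \<in> {0..<2*N+2}" "hole N (hprod N x y) \<noteq> hole N x" "hprod N x y = hprod N y x"
    using hprod_closed hprod_commute assms by auto
  assume "z \<in> {0..<2*N+2}" "hole N x \<noteq> hole N z" "hprod N x y = hprod N x z"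
  then show "y = z" using hprod_cancel assms \<open>x \<in> _\<close> \<open>y \<in> _\<close> \<open>hole N x \<noteq> hole N y\<close> by blast
qed simp

lemma card_hole:
  assumes "N > 0" "x \<in> {0..<2*N+2}"
  shows "card {y \<in> {0..<2*N+2}. hole N y = hole N x} = 2"
proof -
  have h: "hole N y = (if y \<ge> 2 * N then N else if y < N then y else y - N)" if "0 \<le> y" for y
  proof (cases "y < N \<or> y \<ge> 2 * N")
    case False
    have "y mod N = (y - N) mod N" by simp
    also have "\<dots> = y - N" using False that by (intro mod_pos_pos_trivial) auto
    finally show ?thesis using False by (simp add: hole_def)
  qed (use that assms(1) in \<open>auto simp: hole_def\<close>)
  define r where "r = hole N x"
  have r: "0 \<le> r" "r \<le> N" using h[of x] assms by (auto simp: r_def)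
  have "y \<in> {0..<2*N+2} \<and> hole N y = r \<longleftrightarrow>
      y \<in> (if r = N then {2 * N, 2 * N + 1} else {r, r + N})" for y
    using h[of y] r assms(1) by (cases "0 \<le> y") auto
  then have "{y \<in> {0..<2*N+2}. hole N y = r} = (if r = N then {2 * N, 2 * N + 1} else {r, r + N})"
    by blast
  then show ?thesis using assms(1) by (simp add: r_def split: if_splits)
qed

lemma exists_steiner_triple_system_with_cross_free_set:
  assumes "k > 0"
  shows "\<exists>(V :: nat set) B X1 X2 X3.
    steiner_triple_system (18 * k + 3) V B \<and> cross_free_set (6 * k) V B X1 X2 X3"
proof -
  \<comment> \<open>Chosen so that the order \<open>2 * N + 2\<close> equals
    \<open>6 * k\<close>.\<close>
  define N where "N = 3 * int k - 1"
  have N: "N \<ge> 2" using assms by (simp add: N_def)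
  interpret holey_commutative_quasigroup "{0..<2*N+2}" "hole N" "hprod N"
    using holey_commutative_quasigroup_hprod[OF N] .
  have "card {0..<2*N+2} = 6 * k" by (simp add: N_def)
  moreover have "{0..<2*N+2} \<noteq> {}" using N by simp
  ultimately obtain V :: "(int \<times> nat) set" and B X1 X2 X3
    where sts: "steiner_triple_system (18 * k + 3) V B" and cf: "cross_free_set (6 * k) V B X1 X2 X3"
    using exists_cross_free_set_filling_size_2_holes card_hole N by auto
  have inj: "inj_on (to_nat :: int \<times> nat \<Rightarrow> nat) V" by (metis inj_to_nat inj_on_subset subset_UNIV)
  have "b \<subseteq> V" if "b \<in> B" for b using sts that unfolding steiner_triple_system_def by blast
  then show ?thesis
    using steiner_triple_system_image[OF sts inj] cross_free_set_image[OF cf inj] by blast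
qed

theorem theorem4:
  fixes k n :: nat
  assumes "k > 0" and "n = 18 * k + 3"
  shows "G n = 6 * k
    \<and> (\<exists>(V :: nat set) B X1 X2 X3.
          steiner_triple_system n V B \<and> cross_free_set (6 * k) V B X1 X2 X3)
    \<and> \<not> (\<exists>(V :: 'a set) B X1 X2 X3.
          steiner_triple_system n V B \<and> cross_free_set (6 * k + 1) V B X1 X2 X3)"
proof (intro conjI)
  \<comment> \<open>Sets of size \<open>6 * k + 1\<close> would exactly partition the points, and
    this size is odd.\<close>
  have n: "n = 3 * (6 * k + 1)" using assms(2) by simp
  show exists: "\<exists>(V :: nat set) B X1 X2 X3.
      steiner_triple_system n V B \<and> cross_free_set (6 * k) V B X1 X2 X3"
    using exists_steiner_triple_system_with_cross_free_set[OF assms(1)] assms(2) by simp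
  show "\<not> (\<exists>(V :: 'a set) B X1 X2 X3.
      steiner_triple_system n V B \<and> cross_free_set (6 * k + 1) V B X1 X2 X3)"
    using cross_free_partition_even[of "6 * k + 1"] unfolding n by fastforce
  have bound: "m \<le> 6 * k"
    if "steiner_triple_system n V B" "cross_free_set m V B X1 X2 X3" for m B X1 X2 X3 and V :: "nat set"
  proof -
    have "m \<le> 6 * k + 1" using cross_free_set_size_bound[OF that] n by simp
    moreover have "m \<noteq> 6 * k + 1" using cross_free_partition_even[of m V B] that n by auto
    ultimately show ?thesis by simp
  qed
  show "G n = 6 * k"
    unfolding G_def
  proof (rule Max_eqI)
    show "finite {m. \<exists>(V :: nat set) B X1 X2 X3.
        steiner_triple_system n V B \<and> cross_free_set m V B X1 X2 X3}"
      by (rule finite_subset[of _ "{..6 * k}"]) (use bound in auto)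
  qed (use bound exists in auto)
qed

end
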